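(* Let $n\ge 3$ and let $S=\{C(r_1),\dots,C(r_n)\}$ be a system of $n$ coplanar concentric circles with given pairwise distinct radii $r_i>0$ and common centre $O$, where $C(r_n)$ is the outer circle. Let $M'(S)$ be the reduced configuration space of $S$-circuits with $p_n$ fixed, and let $L:M'(S)\to\mathbb{R}$ be the perimeter. Then: (a) The critical points of $L$ on $M'(S)$ are exactly the Fermat $S$-circuits. (b) For each stationary circuit $P$ (critical point of $L$ on $M'(S)$) there exists a circle, concentric with the circles of $S$, such that each side of $P$ or its straight line continuation is tangent to that circle (where, when all vertices of $P$ lie on one line through $O$, the circle is understood to be the single point $O$, of radius $0$, tangency meaning that the line passes through $O$).
   Context: $C(r)$ denotes the circle of radius $r$ centred at $O$. An $S$-circuit (connecting cycle) is an ordered collection $P=(p_1,\dots,p_n)$ with $p_i\in C(r_i)$, regarded as the closed $n$-gon with sides $p_ip_{i+1}$ (indices modulo $n$). Its perimeter is $L(P)=\sum_{i=1}^n |p_ip_{i+1}|$. The reduced configuration space $M'(S)$ is the set of $S$-circuits for which $p_n$ is a fixed point of the outer circle $C(r_n)$ (the intersection of the outer circle with the positive $x$-axis, $O$ being the origin); it is identified with the torus $\mathbb{T}^{n-1}$ via the polar angles of $p_1,\dots,p_{n-1}$. A Fermat $S$-circuit is an $S$-circuit such that at each vertex $p_i$ ($i=1,\dots,n$) one of the following holds: either the line through $O$ and $p_i$ bisects the angle $\angle p_{i-1}p_ip_{i+1}$ formed by the two adjacent sides (this includes the case where both sides lie along the line $Op_i$ on the same side of $p_i$), or the two adjacent sides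 are straight line continuations of each other, i.e. $p_i$ lies on the segment $p_{i-1}p_{i+1}$. A circuit all of whose vertices lie on one line through $O$ is called a parade; by convention its tangential circle consists of the centre $O$ only and has radius $0$. *)

theory Defs
  imports "HOL-Analysis.Analysis"
begin

text \<open>The plane is \<^typ>\<open>complex\<close> and the common centre is \<^term>\<open>0\<close>. Vertices are numbered
  \<^term>\<open>1::nat\<close>, ..., \<open>n\<close>; the index set is cyclic.\<close>

definition next_vertex :: "nat \<Rightarrow> nat \<Rightarrow> nat" where
  "next_vertex n i = (if i = n then 1 else i + 1)"

definition prev_vertex :: "nat \<Rightarrow> nat \<Rightarrow> nat" where
  "prev_vertex n i = (if i = 1 then n else i - 1)"

definition circuits :: "nat \<Rightarrow> (nat \<Rightarrow> real) \<Rightarrow> (nat \<Rightarrow> complex) set" where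
  "circuits n r = (\<Pi>\<^sub>E i\<in>{1..n}. sphere 0 (r i))"

definition reduced_circuits :: "nat \<Rightarrow> (nat \<Rightarrow> real) \<Rightarrow> (nat \<Rightarrow> complex) set" where
  "reduced_circuits n r = {P \<in> circuits n r. P n = complex_of_real (r n)}"

definition perimeter :: "nat \<Rightarrow> (nat \<Rightarrow> complex) \<Rightarrow> real" where
  "perimeter n P = (\<Sum>i = 1..n. dist (P i) (P (next_vertex n i)))"

text \<open>Polar angles of the first \<open>n - 1\<close> vertices; this map factors through the torus.\<close>

definition circuit_of_angles :: "nat \<Rightarrow> (nat \<Rightarrow> real) \<Rightarrow> (nat \<Rightarrow> real) \<Rightarrow> nat \<Rightarrow> complex" where
  "circuit_of_angles n r \<theta> =
     (\<lambda>i\<in>{1..n}. if i = n then complex_of_real (r n) else rcis (r i) (\<theta> i))"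

lemma circuit_of_angles_image:
  assumes "1 \<le> n" and "\<And>i. i \<in> {1..n} \<Longrightarrow> 0 < r i"
  shows "range (circuit_of_angles n r) = reduced_circuits n r"
proof (intro equalityI subsetI)
  fix P assume "P \<in> range (circuit_of_angles n r)"
  then obtain \<theta> where P: "P = circuit_of_angles n r \<theta>" by blast
  have "\<bar>r i\<bar> = r i" if "i \<in> {1..n}" for i
    using assms(2)[OF that] by simp
  then show "P \<in> reduced_circuits n r"
    using assms(1) unfolding P reduced_circuits_def circuits_def circuit_of_angles_def
    by (auto simp: PiE_iff extensional_def)
next
  fix P assume P: "P \<in> reduced_circuits n r"
  have "P = circuit_of_angles n r (\<lambda>i. Arg (P i))"
  proof
    fix i
    show "P i = circuit_of_angles n r (\<lambda>i. Arg (P i)) i"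
    proof (cases "i \<in> {1..n}")
      case True
      then have "cmod (P i) = r i"
        using P by (auto simp: reduced_circuits_def circuits_def PiE_iff)
      then have "rcis (r i) (Arg (P i)) = P i"
        by (metis rcis_cmod_Arg)
      then show ?thesis
        using True P by (auto simp: circuit_of_angles_def reduced_circuits_def)
    next
      case False
      then show ?thesis
        using P by (auto simp: circuit_of_angles_def reduced_circuits_def circuits_def PiE_iff extensional_def)
    qed
  qed
  then show "P \<in> range (circuit_of_angles n r)" by blast
qed

text \<open>The differential of the perimeter vanishes at \<open>P\<close>: the perimeter has derivative zero along
  every curve through \<open>P\<close> in the torus (given in angular coordinates) that is differentiable at
  \<open>P\<close>. Taking coordinate lines as curves, all partial derivatives with respect to the
  polar angles vanish.\<close>

definition critical_circuits :: "nat \<Rightarrow> (nat \<Rightarrow> real) \<Rightarrow> (nat \<Rightarrow> complex) set" where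
  "critical_circuits n r = {P \<in> reduced_circuits n r.
     \<forall>\<theta> :: real \<Rightarrow> nat \<Rightarrow> real.
       circuit_of_angles n r (\<theta> 0) = P \<longrightarrow>
       (\<forall>i\<in>{1..<n}. (\<lambda>t. \<theta> t i) differentiable (at 0)) \<longrightarrow>
       ((\<lambda>t. perimeter n (circuit_of_angles n r (\<theta> t))) has_real_derivative 0) (at 0)}"

definition angle :: "complex \<Rightarrow> complex \<Rightarrow> complex \<Rightarrow> real" where
  "angle a p b = arccos (((a - p) \<bullet> (b - p)) / (norm (a - p) * norm (b - p)))"

text \<open>A line through \<open>p\<close> bisects the angle at \<open>p\<close> if one of its two rays from \<open>p\<close> does. Requiring
  halves of the (unoriented) angle, rather than just equal parts, matters when the two sides
  coincide: every line through \<open>p\<close> splits a zero angle into equal parts.\<close>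

definition bisects_angle :: "complex set \<Rightarrow> complex \<Rightarrow> complex \<Rightarrow> complex \<Rightarrow> bool" where
  "bisects_angle l a p b \<longleftrightarrow>
     (\<exists>q\<in>l. q \<noteq> p \<and> angle a p q = angle a p b / 2 \<and> angle q p b = angle a p b / 2)"

definition fermat_circuits :: "nat \<Rightarrow> (nat \<Rightarrow> real) \<Rightarrow> (nat \<Rightarrow> complex) set" where
  "fermat_circuits n r = {P \<in> circuits n r. \<forall>i\<in>{1..n}.
     bisects_angle (affine hull {0, P i}) (P (prev_vertex n i)) (P i) (P (next_vertex n i)) \<or>
     P i \<in> closed_segment (P (prev_vertex n i)) (P (next_vertex n i))}"

definition parade :: "nat \<Rightarrow> (nat \<Rightarrow> complex) \<Rightarrow> bool" where
  "parade n P \<longleftrightarrow> collinear (insert 0 (P ` {1..n}))"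

text \<open>A line is tangent to a circle iff they have exactly one common point. As
  \<^term>\<open>sphere 0 0 = {0 :: complex}\<close>, for radius \<open>0\<close> and centre \<open>0\<close> this says that the line
  passes through \<open>0\<close>.\<close>

definition line_tangent_to_circle :: "complex set \<Rightarrow> complex \<Rightarrow> real \<Rightarrow> bool" where
  "line_tangent_to_circle l c \<rho> \<longleftrightarrow> (\<exists>!q. q \<in> l \<inter> sphere c \<rho>)"

end

theory Submission
  imports Defs
begin

text \<open>Let \<open>h\<^sub>i\<close> be the signed distance from the centre to the oriented line \<open>p\<^sub>i p\<^sub>i\<^sub>+\<^sub>1\<close>. Turning \<open>p\<^sub>i\<close>
  about the centre changes the perimeter at the rate \<open>h\<^sub>i\<^sub>-\<^sub>1 - h\<^sub>i\<close>, so a circuit is critical iff all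
  \<open>h\<^sub>i\<close> agree (the fixed vertex \<open>p\<^sub>n\<close> imposes no condition of its own, but \<open>n - 1\<close> cyclically
  consecutive equalities imply the last one). The common value of \<open>\<bar>h\<^sub>i\<bar>\<close> is the radius of the
  tangential circle, and \<open>h\<^sub>i\<^sub>-\<^sub>1 = h\<^sub>i\<close> says that the unit vectors from \<open>p\<^sub>i\<close> to its neighbours have
  opposite components orthogonal to \<open>p\<^sub>i\<close>, i.e. they are opposite or mirror images in the line
  \<open>O p\<^sub>i\<close>.\<close>

section \<open>Signed distance, rate of change of a side, and tangency\<close>

text \<open>This is the cross product of \<open>a\<close> with the unit direction of the side,
  positive when the centre lies to the left. The factor \<open>\<i> * a\<close> is also the velocity
  of \<open>a\<close> under a unit-speed turn about the centre, so the same number measures how the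
  side length reacts to such a turn.\<close>

definition signed_dist :: "complex \<Rightarrow> complex \<Rightarrow> real" where
  "signed_dist a b = (\<i> * a) \<bullet> sgn (b - a)"

lemma inner_i_mult_self: "(\<i> * z) \<bullet> z = 0"
  by (simp add: inner_complex_def)

lemma inner_i_mult_sgn_self: "(\<i> * z) \<bullet> sgn z = 0"
  by (simp add: sgn_div_norm inner_i_mult_self)

text \<open>A quarter turn of the side is orthogonal to the side, so either endpoint may represent
  the line. This makes both ends of a side contribute the same signed distance to the variation of
  its length.\<close>

lemma signed_dist_endpoint: "signed_dist a b = (\<i> * b) \<bullet> sgn (b - a)"
proof -
  have "(\<i> * b) \<bullet> sgn (b - a) - signed_dist a b = (\<i> * (b - a)) \<bullet> sgn (b - a)"
    by (simp add: signed_dist_def algebra_simps inner_diff_left)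
  then show ?thesis
    by (simp only: inner_i_mult_sgn_self)
qed

lemma signed_dist_eq_0_iff:
  assumes "a \<noteq> 0" "a \<noteq> b"
  shows "signed_dist a b = 0 \<longleftrightarrow> (\<exists>c. b = c *\<^sub>R a)"
proof
  assume "signed_dist a b = 0"
  then have "(\<i> * a) \<bullet> (b - a) = 0"
    using assms by (simp add: signed_dist_def sgn_div_norm)
  then have eq: "Re a * Im b = Im a * Re b"
    by (simp add: inner_complex_def algebra_simps)
  \<comment> \<open>The vanishing cross product says that \<open>b * cnj a\<close> is real; dividing
    by the squared modulus of \<open>a\<close> yields the scalar.\<close>
  have "Im (b * cnj a) = 0"
    using eq by (simp add: mult.commute)
  then have "b * cnj a = of_real (Re (b * cnj a))"
    by (simp add: complex_eq_iff)
  then have "b = of_real (Re (b * cnj a) / (cmod a)\<^sup>2) * a"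
    using assms(1) complex_norm_square[of a]
    by (simp add: field_simps power2_eq_square)
  then show "\<exists>c. b = c *\<^sub>R a"
    by (metis scaleR_conv_of_real)
next
  assume "\<exists>c. b = c *\<^sub>R a"
  then obtain c where "b = c *\<^sub>R a" ..
  then have "b - a = (c - 1) *\<^sub>R a"
    by (simp add: algebra_simps)
  then show "signed_dist a b = 0"
    by (simp add: signed_dist_def sgn_scaleR inner_i_mult_sgn_self)
qed

text \<open>Away from the origin the gradient of the norm is \<open>sgn\<close>; the chain rule
  gives the rest.\<close>

lemma has_real_derivative_dist:
  fixes f g :: "real \<Rightarrow> 'a::real_inner"
  assumes "(f has_vector_derivative f') (at t)" "(g has_vector_derivative g') (at t)" "f t \<noteq> g t"
  shows "((\<lambda>t. dist (f t) (g t)) has_real_derivative (g' - f') \<bullet> sgn (g t - f t)) (at t)"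
proof -
  have "((\<lambda>t. g t - f t) has_derivative (\<lambda>x. x *\<^sub>R (g' - f'))) (at t)"
    using assms(1,2) has_vector_derivative_diff[of g g' "at t" f f']
    by (simp add: has_vector_derivative_def)
  note has_derivative_compose[OF this has_derivative_norm[of "g t - f t"]]
  moreover have "(\<lambda>t. dist (f t) (g t)) = (\<lambda>t. norm (g t - f t))"
    by (simp add: dist_norm norm_minus_commute)
  moreover note assms(3)
  ultimately show ?thesis
    by (simp add: has_field_derivative_def inner_commute mult.commute mult_commute_abs)
qed

text \<open>Let \<open>f\<close> be the foot of the perpendicular from the centre and
  \<open>u\<close> the unit direction of the line. The point \<open>f + s *\<^sub>R u\<close> has
  squared norm equal to the squared signed distance plus the square of \<open>s\<close>, so only
  \<open>s = 0\<close> meets the circle. Radius 0 is covered by the same computation.\<close>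

lemma line_tangent_to_circle_signed_dist:
  assumes "a \<noteq> b"
  shows "line_tangent_to_circle (affine hull {a, b}) 0 \<bar>signed_dist a b\<bar>"
proof -
  define u where "u = sgn (b - a)"
  define f where "f = a - (a \<bullet> u) *\<^sub>R u"
  have u: "u \<bullet> u = 1"
    using assms by (simp add: u_def dot_square_norm norm_sgn)
  have fu: "f \<bullet> u = 0"
    by (simp add: f_def inner_diff_left u)
  \<comment> \<open>Lagrange's identity: squared cross product plus squared inner product is the
    product of the squared lengths.\<close>
  have "(signed_dist a b)\<^sup>2 + (a \<bullet> u)\<^sup>2 = (a \<bullet> a) * (u \<bullet> u)"
    unfolding signed_dist_def u_def[symmetric]
    by (simp add: inner_complex_def power2_eq_square algebra_simps)
  then have ff: "f \<bullet> f = (signed_dist a b)\<^sup>2"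
    using u by (simp add: f_def inner_diff inner_commute power2_eq_square algebra_simps)
  have ba: "b - a = norm (b - a) *\<^sub>R u"
    using assms by (simp add: u_def sgn_div_norm)
  have hull: "affine hull {a, b} = {f + s *\<^sub>R u |s. True}"
  proof (intro equalityI subsetI)
    fix q assume "q \<in> affine hull {a, b}"
    then obtain v w where "v + w = 1" "q = v *\<^sub>R a + w *\<^sub>R b"
      by (auto simp: affine_hull_2)
    then have "q = a + w *\<^sub>R (b - a)"
      by (simp add: algebra_simps flip: scaleR_add_left)
    then have "q = f + (w * norm (b - a) + a \<bullet> u) *\<^sub>R u"
      by (subst (asm) ba) (simp add: f_def algebra_simps)
    then show "q \<in> {f + s *\<^sub>R u |s. True}"
      by blast
  next
    fix q assume "q \<in> {f + s *\<^sub>R u |s. True}"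
    then obtain s where q: "q = f + s *\<^sub>R u"
      by blast
    \<comment> \<open>Solves \<open>w * norm (b - a) + a \<bullet> u = s\<close>, turning the length
      counted from the foot into the affine parameter counted from \<open>a\<close>.\<close>
    define w where "w = (s - a \<bullet> u) / norm (b - a)"
    have "w *\<^sub>R (b - a) = (s - a \<bullet> u) *\<^sub>R u"
      using assms by (subst ba) (simp add: w_def)
    then have "q = a + w *\<^sub>R (b - a)"
      by (simp add: q f_def algebra_simps)
    then have "q = (1 - w) *\<^sub>R a + w *\<^sub>R b"
      by (simp add: algebra_simps)
    then show "q \<in> affine hull {a, b}"
      unfolding affine_hull_2 by (smt (verit, best) mem_Collect_eq)
  qed
  have norm_iff: "norm (f + s *\<^sub>R u) = \<bar>signed_dist a b\<bar> \<longleftrightarrow> s = 0" for s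
  proof -
    have "(norm (f + s *\<^sub>R u))\<^sup>2 = (signed_dist a b)\<^sup>2 + s\<^sup>2"
      unfolding power2_norm_eq_inner
      using fu u ff by (simp add: inner_add inner_commute power2_eq_square)
    moreover have "norm (f + s *\<^sub>R u) = \<bar>signed_dist a b\<bar> \<longleftrightarrow>
        (norm (f + s *\<^sub>R u))\<^sup>2 = (signed_dist a b)\<^sup>2"
      by (metis abs_norm_cancel power2_eq_iff abs_eq_iff)
    ultimately show ?thesis
      by simp
  qed
  show ?thesis
    unfolding line_tangent_to_circle_def hull
  proof (intro ex1I)
    show "f \<in> {f + s *\<^sub>R u |s. True} \<inter> sphere 0 \<bar>signed_dist a b\<bar>"
      using norm_iff[of 0] by auto
  next
    fix q assume "q \<in> {f + s *\<^sub>R u |s. True} \<inter> sphere 0 \<bar>signed_dist a b\<bar>"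
    then obtain s where q: "q = f + s *\<^sub>R u" and "norm q = \<bar>signed_dist a b\<bar>"
      by auto
    then have "s = 0"
      using norm_iff by blast
    then show "q = f"
      by (simp add: q)
  qed
qed

section \<open>The Fermat condition at a single vertex\<close>

lemma angle_sgn: "angle a p b = arccos (sgn (a - p) \<bullet> sgn (b - p))"
  by (simp add: angle_def sgn_div_norm divide_inverse ac_simps)

lemma mem_closed_segment_iff_sgn:
  fixes p :: "'a::real_inner"
  assumes "a \<noteq> p" "b \<noteq> p"
  shows "p \<in> closed_segment a b \<longleftrightarrow> sgn (a - p) = - sgn (b - p)"
proof
  assume "p \<in> closed_segment a b"
  then obtain t where t: "0 \<le> t" "t \<le> 1" "p = (1 - t) *\<^sub>R a + t *\<^sub>R b"
    by (auto simp: in_segment)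
  have a: "a - p = t *\<^sub>R (a - b)" and b: "b - p = (1 - t) *\<^sub>R (b - a)"
    by (simp_all add: t(3) algebra_simps)
  \<comment> \<open>Since \<open>p\<close> is neither endpoint, both scaling factors are positive
    and drop out of \<open>sgn\<close>.\<close>
  have "t \<noteq> 0" "t \<noteq> 1"
    using assms a b by auto
  with t(1,2) have "t > 0" "t < 1"
    by auto
  then show "sgn (a - p) = - sgn (b - p)"
    unfolding a b by (simp add: sgn_scaleR flip: sgn_minus)
next
  assume eq: "sgn (a - p) = - sgn (b - p)"
  let ?s = "norm (a - p)" and ?t = "norm (b - p)"
  have pos: "?s + ?t > 0"
    using assms by (simp add: add_pos_pos)
  have "a - p = ?s *\<^sub>R sgn (a - p)" "b - p = ?t *\<^sub>R sgn (b - p)"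
    using assms by (simp_all add: sgn_div_norm)
  \<comment> \<open>Weighting each end by the distance of the other one makes the opposite unit
    vectors cancel; \<open>p\<close> divides the segment in the ratio of \<open>?s\<close> to
    \<open>?t\<close>.\<close>
  then have "?t *\<^sub>R (a - p) + ?s *\<^sub>R (b - p) = 0"
    using eq by (metis add.left_inverse mult.commute scaleR_minus_right scaleR_scaleR)
  then have "(?s + ?t) *\<^sub>R p = ?t *\<^sub>R a + ?s *\<^sub>R b"
    by (simp add: algebra_simps)
  then have "inverse (?s + ?t) *\<^sub>R ((?s + ?t) *\<^sub>R p) = inverse (?s + ?t) *\<^sub>R (?t *\<^sub>R a + ?s *\<^sub>R b)"
    by (rule arg_cong)
  then have "p = inverse (?s + ?t) *\<^sub>R (?t *\<^sub>R a + ?s *\<^sub>R b)"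
    using pos by simp
  moreover have "1 - ?s / (?s + ?t) = ?t / (?s + ?t)"
    using pos by (simp add: field_simps)
  ultimately have "p = (1 - ?s / (?s + ?t)) *\<^sub>R a + (?s / (?s + ?t)) *\<^sub>R b"
    by (simp add: scaleR_add_right divide_inverse mult.commute)
  then show "p \<in> closed_segment a b"
    unfolding in_segment using pos by (intro exI[of _ "?s / (?s + ?t)"]) (simp add: divide_simps)
qed

lemma mem_line_through_0: "q \<in> affine hull {0, p} \<longleftrightarrow> (\<exists>k. q = k *\<^sub>R p)"
  for p :: "'a::real_vector"
proof -
  have "q = k *\<^sub>R p \<Longrightarrow> \<exists>u v. q = v *\<^sub>R p \<and> u + v = 1" for k
    by (rule exI[of _ "1 - k"]) auto
  then show ?thesis
    by (auto simp: affine_hull_2)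
qed

text \<open>Parseval's identity and the expansion in the orthonormal basis \<open>u\<close>,
  \<open>\<i> * u\<close>.\<close>

lemma complex_orthonormal_coords:
  assumes "norm (u::complex) = 1"
  shows "a \<bullet> b = (u \<bullet> a) * (u \<bullet> b) + ((\<i> * u) \<bullet> a) * ((\<i> * u) \<bullet> b)"
    and "a = (u \<bullet> a) *\<^sub>R u + ((\<i> * u) \<bullet> a) *\<^sub>R (\<i> * u)"
proof -
  have u: "(Re u)\<^sup>2 + (Im u)\<^sup>2 = 1"
    using assms by (simp add: cmod_def)
  have "(u \<bullet> a) * (u \<bullet> b) + ((\<i> * u) \<bullet> a) * ((\<i> * u) \<bullet> b) = ((Re u)\<^sup>2 + (Im u)\<^sup>2) * (a \<bullet> b)"
    by (simp add: inner_complex_def power2_eq_square algebra_simps)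
  with u show "a \<bullet> b = (u \<bullet> a) * (u \<bullet> b) + ((\<i> * u) \<bullet> a) * ((\<i> * u) \<bullet> b)"
    by simp
  have "(u \<bullet> a) *\<^sub>R u + ((\<i> * u) \<bullet> a) *\<^sub>R (\<i> * u) = ((Re u)\<^sup>2 + (Im u)\<^sup>2) *\<^sub>R a"
    by (simp add: inner_complex_def complex_eq_iff power2_eq_square algebra_simps)
  with u show "a = (u \<bullet> a) *\<^sub>R u + ((\<i> * u) \<bullet> a) *\<^sub>R (\<i> * u)"
    by simp
qed

text \<open>For nonnegative \<open>x\<close> the doubled angle stays within \<open>[0, pi]\<close>,
  the range of \<open>arccos\<close>, so the double-angle formula can be inverted.\<close>

lemma arccos_double:
  assumes "0 \<le> x" "x \<le> 1"
  shows "arccos (2 * x\<^sup>2 - 1) = 2 * arccos x"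
proof -
  have "cos (2 * arccos x) = 2 * x\<^sup>2 - 1"
    using assms by (simp add: cos_double_cos)
  moreover have "arccos x \<le> pi / 2"
    using assms by (metis arccos_0 arccos_le_arccos neg_le_0_iff_le order.trans zero_le_one)
  ultimately show ?thesis
    using assms arccos_cos[of "2 * arccos x"] arccos_lbound[of x] by simp
qed

text \<open>In the frame \<open>u\<close>, \<open>\<i> * u\<close> with \<open>u\<close> along
  \<open>p\<close>, the right-hand side says that the unit vectors \<open>A\<close> and
  \<open>B\<close> towards the neighbours have opposite transversal components. Their radial
  components then have equal squares: equal ones make \<open>A\<close> and \<open>B\<close> mirror
  images in the line, opposite ones make the sides continue each other.\<close>

lemma fermat_vertex_iff:
  assumes "p \<noteq> 0" "a \<noteq> p" "b \<noteq> p"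
  shows "bisects_angle (affine hull {0, p}) a p b \<or> p \<in> closed_segment a b \<longleftrightarrow>
         signed_dist p a + signed_dist p b = 0"
proof -
  define A where "A = sgn (a - p)"
  define B where "B = sgn (b - p)"
  define u where "u = sgn p"
  have nA: "norm A = 1" and nB: "norm B = 1" and nu: "norm u = 1"
    using assms by (simp_all add: A_def B_def u_def norm_sgn)
  note coords = complex_orthonormal_coords[OF nu]
  have p: "p = norm p *\<^sub>R u"
    using assms by (simp add: u_def sgn_div_norm)
  have "(\<i> * p) \<bullet> z = norm p * ((\<i> * u) \<bullet> z)" for z
    by (subst p) simp
  then have sd: "signed_dist p a + signed_dist p b = 0 \<longleftrightarrow> (\<i> * u) \<bullet> A = - ((\<i> * u) \<bullet> B)"
    using assms(1) unfolding signed_dist_def A_def[symmetric] B_def[symmetric]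
    by (simp flip: distrib_left) linarith
  have seg: "p \<in> closed_segment a b \<longleftrightarrow> A = - B"
    using mem_closed_segment_iff_sgn assms by (simp add: A_def B_def)
  have unit: "(u \<bullet> A)\<^sup>2 + ((\<i> * u) \<bullet> A)\<^sup>2 = 1" "(u \<bullet> B)\<^sup>2 + ((\<i> * u) \<bullet> B)\<^sup>2 = 1"
    using coords(1)[of A A] coords(1)[of B B] nA nB
    by (simp_all add: power2_eq_square dot_square_norm)
  have angle_q: "angle a p (p + s *\<^sub>R u) = arccos (s * (u \<bullet> A))"
    "angle (p + s *\<^sub>R u) p b = arccos (s * (u \<bullet> B))" if "\<bar>s\<bar> = 1" for s :: real
    using that by (auto simp: angle_sgn sgn_scaleR u_def A_def B_def inner_commute abs_if split: if_splits)
  have angle_ab: "angle a p b = arccos (A \<bullet> B)"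
    by (simp add: angle_sgn A_def B_def)
  show ?thesis
    unfolding sd seg
  proof
    assume "bisects_angle (affine hull {0, p}) a p b \<or> A = - B"
    then show "(\<i> * u) \<bullet> A = - ((\<i> * u) \<bullet> B)"
    proof
      assume "bisects_angle (affine hull {0, p}) a p b"
      then obtain k where k: "k *\<^sub>R p \<noteq> p"
        "angle a p (k *\<^sub>R p) = angle a p b / 2" "angle (k *\<^sub>R p) p b = angle a p b / 2"
        by (auto simp: bisects_angle_def mem_line_through_0)
      \<comment> \<open>This sign tells which of the two rays of the line from \<open>p\<close>
        contains the bisecting point; the direction of that ray is
        \<open>s *\<^sub>R u\<close>.\<close>
      define s where "s = sgn (k - 1)"
      have s: "\<bar>s\<bar> = 1"
        using k(1) by (auto simp: s_def abs_sgn_eq)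
      have "k *\<^sub>R p - p = (k - 1) *\<^sub>R p"
        by (simp add: algebra_simps)
      then have "sgn (k *\<^sub>R p - p) = s *\<^sub>R u"
        by (simp add: s_def u_def sgn_scaleR)
      then have A': "arccos (s * (u \<bullet> A)) = arccos (A \<bullet> B) / 2"
        and B': "arccos (s * (u \<bullet> B)) = arccos (A \<bullet> B) / 2"
        using k(2,3) angle_ab by (simp_all add: angle_sgn A_def B_def inner_commute)
      have le1: "\<bar>s * (u \<bullet> A)\<bar> \<le> 1" "\<bar>s * (u \<bullet> B)\<bar> \<le> 1"
        using s nA nB nu Cauchy_Schwarz_ineq2[of u A] Cauchy_Schwarz_ineq2[of u B]
        by (simp_all add: abs_mult)
      have sAB: "s * (u \<bullet> A) = s * (u \<bullet> B)"
        using A' B' le1 arccos_eq_iff by metis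
      then have AB: "u \<bullet> A = u \<bullet> B"
        using s by auto
      then have "((\<i> * u) \<bullet> A)\<^sup>2 = ((\<i> * u) \<bullet> B)\<^sup>2"
        using unit by simp
      then consider "(\<i> * u) \<bullet> A = - ((\<i> * u) \<bullet> B)" | "(\<i> * u) \<bullet> A = (\<i> * u) \<bullet> B"
        using power2_eq_iff by blast
      then show ?thesis
      proof cases
        \<comment> \<open>Here the two sides coincide and enclose the angle 0. Its half is 0 as
          well, so the bisecting ray points along \<open>A\<close>; the transversal components
          vanish and are thus opposite too.\<close>
        case 2
        then have "A = B"
          using AB coords(2)[of A] coords(2)[of B] by simp
        then have "arccos (s * (u \<bullet> A)) = 0"
          using A' nA by (simp add: dot_square_norm)
        then have "s * (u \<bullet> A) = 1"
          using le1(1) by (metis arccos_1 arccos_eq_iff abs_one order_refl)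
        then have "(u \<bullet> A)\<^sup>2 = 1"
          using s by (metis abs_mult abs_one mult_1 power2_abs power_one)
        then show ?thesis
          using unit(1) 2 by simp
      qed
    qed simp
  next
    assume eq: "(\<i> * u) \<bullet> A = - ((\<i> * u) \<bullet> B)"
    then have "(u \<bullet> A)\<^sup>2 = (u \<bullet> B)\<^sup>2"
      using unit by simp
    \<comment> \<open>Two vanishing radial components count as the first case, so that
      \<open>s\<close> below is a genuine sign.\<close>
    then consider "u \<bullet> A = - (u \<bullet> B)" | "u \<bullet> A = u \<bullet> B" "u \<bullet> A \<noteq> 0"
      using power2_eq_iff[of "u \<bullet> A" "u \<bullet> B"] by fastforce
    then show "bisects_angle (affine hull {0, p}) a p b \<or> A = - B"
    proof cases
      case 1
      then have "A = - ((u \<bullet> B) *\<^sub>R u + ((\<i> * u) \<bullet> B) *\<^sub>R (\<i> * u))"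
        using eq coords(2)[of A] by simp
      then have "A = - B"
        by (simp only: coords(2)[of B, symmetric])
      then show ?thesis ..
    next
      case 2
      \<comment> \<open>The ray is chosen on the side towards which \<open>A\<close> and
        \<open>B\<close> both lean. Its angle with each of them is then at most a right angle, and
        \<open>arccos_double\<close> identifies it as half the angle between the sides.\<close>
      define s where "s = sgn (u \<bullet> A)"
      have s: "\<bar>s\<bar> = 1" "s * (u \<bullet> A) = \<bar>u \<bullet> A\<bar>"
        using 2 by (auto simp: s_def abs_sgn_eq mult.commute abs_sgn)
      have "A \<bullet> B = (u \<bullet> A)\<^sup>2 - ((\<i> * u) \<bullet> A)\<^sup>2"
        using coords(1)[of A B] eq 2 by (simp add: power2_eq_square)
      then have "A \<bullet> B = 2 * \<bar>u \<bullet> A\<bar>\<^sup>2 - 1"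
        using unit(1) by simp
      moreover have "\<bar>u \<bullet> A\<bar> \<le> 1"
        using Cauchy_Schwarz_ineq2[of u A] nA nu by simp
      ultimately have "arccos (A \<bullet> B) = 2 * arccos \<bar>u \<bullet> A\<bar>"
        using arccos_double[of "\<bar>u \<bullet> A\<bar>"] by simp
      moreover have "p + s *\<^sub>R u \<in> affine hull {0, p}"
        using assms(1) unfolding mem_line_through_0
        by (intro exI[of _ "1 + s / norm p"]) (simp add: u_def sgn_div_norm algebra_simps divide_inverse)
      moreover have "p + s *\<^sub>R u \<noteq> p"
        using s nu by auto
      ultimately have "bisects_angle (affine hull {0, p}) a p b"
        using angle_q[OF s(1)] angle_ab 2 s(2) unfolding bisects_angle_def
        by (intro bexI[of _ "p + s *\<^sub>R u"]) auto
      then show ?thesis ..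
    qed
  qed
qed

section \<open>Cyclic indices and distinctness of vertices\<close>

lemma next_vertex_in: "i \<in> {1..n} \<Longrightarrow> next_vertex n i \<in> {1..n}"
  and prev_vertex_in: "i \<in> {1..n} \<Longrightarrow> prev_vertex n i \<in> {1..n}"
  and next_prev_vertex: "i \<in> {1..n} \<Longrightarrow> next_vertex n (prev_vertex n i) = i"
  and prev_next_vertex: "i \<in> {1..n} \<Longrightarrow> prev_vertex n (next_vertex n i) = i"
  by (auto simp: next_vertex_def prev_vertex_def)

lemma sum_next_vertex: "(\<Sum>i = 1..n. f (next_vertex n i)) = sum f {1..n}"
  by (rule sum.reindex_bij_witness[of _ "prev_vertex n" "next_vertex n"])
    (use next_vertex_in prev_vertex_in next_prev_vertex prev_next_vertex in auto)

abbreviation side_dist :: "nat \<Rightarrow> (nat \<Rightarrow> complex) \<Rightarrow> nat \<Rightarrow> real" where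
  "side_dist n P i \<equiv> signed_dist (P i) (P (next_vertex n i))"

text \<open>Different radii give different norms. Hence no side degenerates to a point, and the
  perimeter is differentiable everywhere.\<close>

lemma circuit_distinct:
  assumes "inj_on r {1..n}" "P \<in> circuits n r" "i \<in> {1..n}" "j \<in> {1..n}" "i \<noteq> j"
  shows "P i \<noteq> P j"
proof
  assume "P i = P j"
  moreover have "norm (P i) = r i" "norm (P j) = r j"
    using assms by (auto simp: circuits_def PiE_iff)
  ultimately show False
    using assms inj_onD[OF assms(1), of i j] by auto
qed

section \<open>Variation of the perimeter and critical circuits\<close>

text \<open>Each vertex moves with \<open>d i\<close> times its own quarter turn, so a side changes
  at the rate of its signed distance times the difference of the angular speeds of its ends. Cyclic
  summation by parts collects the coefficient of each \<open>d i\<close>. The fixed vertex is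
  encoded by \<open>d n = 0\<close>.\<close>

lemma has_real_derivative_perimeter:
  assumes "circuit_of_angles n r (\<theta> 0) = P"
    and distinct: "\<And>i. i \<in> {1..n} \<Longrightarrow> P i \<noteq> P (next_vertex n i)"
    and deriv: "\<And>i. i \<in> {1..<n} \<Longrightarrow> ((\<lambda>t. \<theta> t i) has_real_derivative d i) (at 0)"
    and "d n = 0"
  shows "((\<lambda>t. perimeter n (circuit_of_angles n r (\<theta> t))) has_real_derivative
          (\<Sum>i = 1..n. d i * (side_dist n P (prev_vertex n i) - side_dist n P i))) (at 0)"
proof -
  let ?C = "\<lambda>t. circuit_of_angles n r (\<theta> t)"
  have vertex: "((\<lambda>t. ?C t i) has_vector_derivative d i *\<^sub>R (\<i> * P i)) (at 0)"
    if i: "i \<in> {1..n}" for i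
  proof (cases "i = n")
    case True
    then show ?thesis
      using i \<open>d n = 0\<close> by (simp add: circuit_of_angles_def)
  next
    case False
    with i have i': "i \<in> {1..<n}"
      by auto
    have "((\<lambda>t. rcis (r i) (\<theta> t i)) has_vector_derivative
        d i *\<^sub>R (\<i> * rcis (r i) (\<theta> 0 i))) (at 0)"
    proof -
      have "((\<lambda>x. rcis (r i) x) has_vector_derivative \<i> * rcis (r i) (\<theta> 0 i)) (at (\<theta> 0 i))"
        unfolding rcis_def cis_conv_exp
        by (auto intro!: derivative_eq_intros has_vector_derivative_real_field)
      from vector_diff_chain_at[OF deriv[OF i', unfolded has_real_derivative_iff_has_vector_derivative] this]
      show ?thesis
        by (simp add: o_def)
    qed
    moreover have "P i = rcis (r i) (\<theta> 0 i)"
      using i False by (auto simp: circuit_of_angles_def simp flip: assms(1))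
    ultimately show ?thesis
      using i False by (simp add: circuit_of_angles_def)
  qed
  have "((\<lambda>t. dist (?C t i) (?C t (next_vertex n i))) has_real_derivative
      d (next_vertex n i) * side_dist n P i - d i * side_dist n P i) (at 0)"
    if i: "i \<in> {1..n}" for i
    using has_real_derivative_dist[OF vertex[OF i] vertex[OF next_vertex_in[OF i]]] distinct[OF i]
    by (simp only: assms(1) inner_diff_left inner_scaleR_left not_False_eq_True
        flip: signed_dist_endpoint signed_dist_def)
  then have "((\<lambda>t. perimeter n (?C t)) has_real_derivative
      (\<Sum>i = 1..n. d (next_vertex n i) * side_dist n P i - d i * side_dist n P i)) (at 0)"
    unfolding perimeter_def by (intro DERIV_sum) auto
  \<comment> \<open>Naming a side by the predecessor of its far end prepares the cyclic shift by
    \<open>sum_next_vertex\<close>.\<close>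
  moreover have "(\<Sum>i = 1..n. d (next_vertex n i) * side_dist n P i) =
      (\<Sum>i = 1..n. d (next_vertex n i) * side_dist n P (prev_vertex n (next_vertex n i)))"
    by (intro sum.cong) (simp_all add: prev_next_vertex)
  ultimately show ?thesis
    using sum_next_vertex[of "\<lambda>i. d i * side_dist n P (prev_vertex n i)" n]
    by (simp add: sum_subtractf right_diff_distrib)
qed

lemma side_dist_const:
  assumes "\<forall>i\<in>{1..<n}. side_dist n P (prev_vertex n i) = side_dist n P i" "i \<in> {1..n}"
  shows "side_dist n P i = side_dist n P n"
proof -
  have "i \<le> n \<Longrightarrow> 1 \<le> i \<Longrightarrow> side_dist n P i = side_dist n P n" for i
  proof (induction i)
    case (Suc i)
    show ?case
    proof (cases "Suc i = n")
      case False
      then have "side_dist n P (prev_vertex n (Suc i)) = side_dist n P (Suc i)"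
        using assms(1) Suc.prems by auto
      \<comment> \<open>For vertex 1 the predecessor is \<open>n\<close> itself, which starts the
        chain of equalities.\<close>
      then show ?thesis
        using Suc by (cases "i = 0") (auto simp: prev_vertex_def)
    qed simp
  qed simp
  then show ?thesis
    using assms(2) unfolding atLeastAtMost_iff by blast
qed

text \<open>Varying a single polar angle isolates one bracket of the derivative formula; conversely,
  if all brackets vanish, the derivative is zero along every admissible curve.\<close>

lemma critical_circuits_iff:
  assumes "1 \<le> n" "\<forall>i\<in>{1..n}. 0 < r i"
    and P: "P \<in> reduced_circuits n r"
    and distinct: "\<And>i. i \<in> {1..n} \<Longrightarrow> P i \<noteq> P (next_vertex n i)"
  shows "P \<in> critical_circuits n r \<longleftrightarrow> (\<forall>i\<in>{1..n}. side_dist n P (prev_vertex n i) = side_dist n P i)"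
proof
  assume crit: "P \<in> critical_circuits n r"
  have "P \<in> range (circuit_of_angles n r)"
    using circuit_of_angles_image[of n r] assms by auto
  then obtain \<phi> where \<phi>: "circuit_of_angles n r \<phi> = P"
    by blast
  have "side_dist n P (prev_vertex n i) = side_dist n P i" if i: "i \<in> {1..<n}" for i
  proof -
    define \<theta> where "\<theta> t j = (if j = i then \<phi> j + t else \<phi> j)" for t :: real and j
    define d :: "nat \<Rightarrow> real" where "d j = (if j = i then 1 else 0)" for j
    have \<theta>0: "circuit_of_angles n r (\<theta> 0) = P"
    proof -
      have "\<theta> 0 = \<phi>"
        by (simp add: \<theta>_def fun_eq_iff)
      with \<phi> show ?thesis
        by simp
    qed
    have \<theta>': "((\<lambda>t. \<theta> t j) has_real_derivative d j) (at 0)" for j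
      by (auto simp: \<theta>_def d_def intro!: derivative_eq_intros)
    then have "(\<lambda>t. \<theta> t j) differentiable (at 0)" for j
      by (meson real_differentiable_def)
    then have "((\<lambda>t. perimeter n (circuit_of_angles n r (\<theta> t))) has_real_derivative 0) (at 0)"
      using crit \<theta>0 unfolding critical_circuits_def by blast
    moreover have "((\<lambda>t. perimeter n (circuit_of_angles n r (\<theta> t))) has_real_derivative
          (\<Sum>j = 1..n. d j * (side_dist n P (prev_vertex n j) - side_dist n P j))) (at 0)"
      using i by (intro has_real_derivative_perimeter \<theta>0 distinct \<theta>') (auto simp: d_def)
    ultimately have "(\<Sum>j = 1..n. d j * (side_dist n P (prev_vertex n j) - side_dist n P j)) = 0"
      using DERIV_unique by blast
    moreover have "d j * x = (if j = i then x else 0)" for j x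
      by (simp add: d_def)
    ultimately show ?thesis
      using i by simp
  qed
  \<comment> \<open>No curve moves vertex \<open>n\<close>, so its equality comes from constancy
    around the cycle.\<close>
  then have "side_dist n P i = side_dist n P n" if "i \<in> {1..n}" for i
    using side_dist_const that by blast
  then show "\<forall>i\<in>{1..n}. side_dist n P (prev_vertex n i) = side_dist n P i"
    using prev_vertex_in by metis
next
  assume eq: "\<forall>i\<in>{1..n}. side_dist n P (prev_vertex n i) = side_dist n P i"
  show "P \<in> critical_circuits n r"
    unfolding critical_circuits_def
  proof (intro CollectI conjI P allI impI)
    fix \<theta> :: "real \<Rightarrow> nat \<Rightarrow> real"
    assume \<theta>0: "circuit_of_angles n r (\<theta> 0) = P"
      and diff: "\<forall>i\<in>{1..<n}. (\<lambda>t. \<theta> t i) differentiable (at 0)"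
    \<comment> \<open>The coordinate \<open>\<theta> t n\<close> does not enter the circuit and may
      fail to be differentiable, hence the value 0 at \<open>n\<close>.\<close>
    define d where "d i = (if i = n then 0 else deriv (\<lambda>t. \<theta> t i) 0)" for i
    have "((\<lambda>t. \<theta> t i) has_real_derivative d i) (at 0)" if "i \<in> {1..<n}" for i
      using diff that by (auto simp: d_def DERIV_deriv_iff_real_differentiable)
    from has_real_derivative_perimeter[OF \<theta>0 distinct this]
    show "((\<lambda>t. perimeter n (circuit_of_angles n r (\<theta> t))) has_real_derivative 0) (at 0)"
      using eq by (simp add: d_def)
  qed
qed

section \<open>Parades\<close>

text \<open>A vanishing signed distance makes each vertex a real multiple of its predecessor, and
  hence of \<open>P 1\<close>. This decides when the tangential circle shrinks to the
  centre.\<close>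

lemma parade_iff_side_dist:
  assumes "1 \<le> n" "\<And>i. i \<in> {1..n} \<Longrightarrow> P i \<noteq> 0"
    and distinct: "\<And>i. i \<in> {1..n} \<Longrightarrow> P i \<noteq> P (next_vertex n i)"
  shows "parade n P \<longleftrightarrow> (\<forall>i\<in>{1..n}. side_dist n P i = 0)"
proof
  assume "parade n P"
  then obtain u where u: "\<And>x y. x \<in> insert 0 (P ` {1..n}) \<Longrightarrow> y \<in> insert 0 (P ` {1..n}) \<Longrightarrow> \<exists>c. x - y = c *\<^sub>R u"
    unfolding parade_def collinear_def by blast
  have line: "\<exists>c. P i = c *\<^sub>R u" if "i \<in> {1..n}" for i
    using u[of "P i" 0] that by auto
  show "\<forall>i\<in>{1..n}. side_dist n P i = 0"
  proof
    fix i assume i: "i \<in> {1..n}"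
    obtain c c' where c: "P i = c *\<^sub>R u" "P (next_vertex n i) = c' *\<^sub>R u"
      using line[OF i] line[OF next_vertex_in[OF i]] by blast
    \<comment> \<open>Because \<open>P i\<close> is nonzero, so is \<open>c\<close>.\<close>
    then have "P (next_vertex n i) = (c' / c) *\<^sub>R P i"
      using assms(2)[OF i] by auto
    then show "side_dist n P i = 0"
      using signed_dist_eq_0_iff assms(2)[OF i] distinct[OF i] by blast
  qed
next
  assume eq: "\<forall>i\<in>{1..n}. side_dist n P i = 0"
  have "i \<le> n \<Longrightarrow> 1 \<le> i \<Longrightarrow> \<exists>c. P i = c *\<^sub>R P 1" for i
  proof (induction i)
    case (Suc i)
    show ?case
    proof (cases "i = 0")
      case True
      then show ?thesis
        by (intro exI[of _ 1]) simp
    next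
      case False
      then have i: "i \<in> {1..n}" and "next_vertex n i = Suc i"
        using Suc.prems by (auto simp: next_vertex_def)
      then obtain c where "P (Suc i) = c *\<^sub>R P i"
        using signed_dist_eq_0_iff assms(2)[OF i] distinct[OF i] eq by metis
      moreover obtain c' where "P i = c' *\<^sub>R P 1"
        using Suc i by auto
      ultimately show ?thesis
        by (intro exI[of _ "c * c'"]) simp
    qed
  qed simp
  then have line: "\<exists>c. x = c *\<^sub>R P 1" if "x \<in> insert 0 (P ` {1..n})" for x
    using that by (auto intro: exI[of _ 0])
  show "parade n P"
    unfolding parade_def collinear_def
  proof (intro exI[of _ "P 1"] ballI)
    fix x y assume "x \<in> insert 0 (P ` {1..n})" "y \<in> insert 0 (P ` {1..n})"
    then show "\<exists>c. x - y = c *\<^sub>R P 1"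
      using line by (metis scaleR_diff_left)
  qed
qed

section \<open>Fermat circuits and the tangential circle\<close>

theorem theorem1:
  fixes n :: nat and r :: "nat \<Rightarrow> real"
  assumes "3 \<le> n"
    and "\<forall>i\<in>{1..n}. 0 < r i"
    and "inj_on r {1..n}"
    and "\<forall>i\<in>{1..n}. r i \<le> r n"
  shows "critical_circuits n r = reduced_circuits n r \<inter> fermat_circuits n r \<and>
         (\<forall>P\<in>critical_circuits n r.
           \<exists>\<rho>. (if parade n P then \<rho> = 0 else 0 < \<rho>) \<and>
               (\<forall>i\<in>{1..n}.
                  line_tangent_to_circle (affine hull {P i, P (next_vertex n i)}) 0 \<rho>))"
proof -
  have n: "1 \<le> n"
    using assms(1) by simp
  have sub: "critical_circuits n r \<subseteq> reduced_circuits n r" "reduced_circuits n r \<subseteq> circuits n r"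
    by (auto simp: critical_circuits_def reduced_circuits_def)
  have nonzero: "P i \<noteq> 0" if "P \<in> circuits n r" "i \<in> {1..n}" for P i
  proof -
    have "norm (P i) = r i"
      using that by (auto simp: circuits_def PiE_iff)
    then show ?thesis
      using assms(2) that(2) by fastforce
  qed
  have next_ne: "P i \<noteq> P (next_vertex n i)" and prev_ne: "P (prev_vertex n i) \<noteq> P i"
    if "P \<in> circuits n r" "i \<in> {1..n}" for P i
  proof -
    have "next_vertex n i \<noteq> i" "prev_vertex n i \<noteq> i"
      using assms(1) that(2) by (auto simp: next_vertex_def prev_vertex_def)
    then show "P i \<noteq> P (next_vertex n i)" "P (prev_vertex n i) \<noteq> P i"
      using circuit_distinct[OF assms(3) that(1)] next_vertex_in prev_vertex_in that(2) by metis+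
  qed
  have crit: "P \<in> critical_circuits n r \<longleftrightarrow>
      (\<forall>i\<in>{1..n}. side_dist n P (prev_vertex n i) = side_dist n P i)"
    if "P \<in> reduced_circuits n r" for P
    using critical_circuits_iff[OF n assms(2) that] next_ne sub that by blast
  have fermat: "P \<in> fermat_circuits n r \<longleftrightarrow>
      (\<forall>i\<in>{1..n}. side_dist n P (prev_vertex n i) = side_dist n P i)"
    if P: "P \<in> circuits n r" for P
  proof -
    \<comment> \<open>Seen from \<open>P i\<close> the incoming side is traversed backwards, which
      flips the sign. The vanishing sum in \<open>fermat_vertex_iff\<close> thereby becomes equality
      of consecutive side distances.\<close>
    have "signed_dist (P i) (P (prev_vertex n i)) = - side_dist n P (prev_vertex n i)"
      if "i \<in> {1..n}" for i
    proof -
      have "sgn (P (prev_vertex n i) - P i) = - sgn (P i - P (prev_vertex n i))"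
        by (metis minus_diff_eq sgn_minus)
      then show ?thesis
        using that signed_dist_endpoint[of "P (prev_vertex n i)" "P i"]
        by (simp add: signed_dist_def[of "P i"] next_prev_vertex)
    qed
    moreover have "P \<in> fermat_circuits n r \<longleftrightarrow> (\<forall>i\<in>{1..n}.
        signed_dist (P i) (P (prev_vertex n i)) + side_dist n P i = 0)"
      using fermat_vertex_iff nonzero[OF P] next_ne[OF P] prev_ne[OF P] P
      unfolding fermat_circuits_def mem_Collect_eq by metis
    ultimately show ?thesis
      by (auto simp: algebra_simps)
  qed
  show ?thesis
  proof (intro conjI ballI)
    show "critical_circuits n r = reduced_circuits n r \<inter> fermat_circuits n r"
      using crit fermat sub by blast
  next
    fix P assume P: "P \<in> critical_circuits n r"
    then have circuit: "P \<in> circuits n r"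
      using sub by blast
    \<comment> \<open>All sides share one signed distance, so the side from \<open>P n\<close> to
      \<open>P 1\<close> may represent them.\<close>
    let ?\<rho> = "\<bar>side_dist n P n\<bar>"
    have "\<forall>i\<in>{1..<n}. side_dist n P (prev_vertex n i) = side_dist n P i"
      using crit P sub by fastforce
    then have const: "side_dist n P i = side_dist n P n" if "i \<in> {1..n}" for i
      using side_dist_const that by blast
    have "parade n P \<longleftrightarrow> (\<forall>i\<in>{1..n}. side_dist n P i = 0)"
      using parade_iff_side_dist[of n P] n nonzero[OF circuit] next_ne[OF circuit] by blast
    also have "\<dots> \<longleftrightarrow> side_dist n P n = 0"
      using const n by (metis atLeastAtMost_iff order_refl)
    finally have parade: "parade n P \<longleftrightarrow> side_dist n P n = 0" .
    have "if parade n P then ?\<rho> = 0 else 0 < ?\<rho>"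
      by (simp only: parade zero_less_abs_iff abs_eq_0 split: if_split) blast
    moreover have "line_tangent_to_circle (affine hull {P i, P (next_vertex n i)}) 0 ?\<rho>"
      if "i \<in> {1..n}" for i
      using line_tangent_to_circle_signed_dist[OF next_ne[OF circuit that]] const[OF that] by simp
    ultimately show "\<exists>\<rho>. (if parade n P then \<rho> = 0 else 0 < \<rho>) \<and> (\<forall>i\<in>{1..n}.
        line_tangent_to_circle (affine hull {P i, P (next_vertex n i)}) 0 \<rho>)"
      by blast
  qed
qed

end
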